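(* Let $\alpha$ be an irrational number with simple continued fraction expansion $\alpha=[b_0;b_1,b_2,\ldots]$. If the partial quotients satisfy the growth restriction $b_n=e^{o(n)}$ as $n\to\infty$ (for example, $b_n$ bounded, or a polynomial in $n$, or $b_n<e^{n/\ln n}$), then $\mu(\alpha)=2$. If $b_n=e^{o(F_n)}$ as $n\to\infty$ (for instance, $b_n<e^{(3/2)^n}$), where $F_n$ is the $n$-th Fibonacci number, then $\beta(\alpha)=1$.
   Context: Irrationality exponent: for a real irrational number $\alpha$, $\mu(\alpha)$ is the least real $\mu>0$ such that for every $\varepsilon>0$ there is a positive integer $q(\varepsilon)$ with $\left|\alpha-\frac pq\right|>q^{-(\mu+\varepsilon)}$ for all integers $p,q$ with $q\ge q(\varepsilon)$; if no such $\mu$ exists, $\mu(\alpha)=\infty$. Irrationality base: $\beta(\alpha)$ is the least real $\beta\ge 1$ such that for every $\varepsilon>0$ there is a positive integer $q(\varepsilon)$ with $\left|\alpha-\frac pq\right|>\frac{1}{(\beta+\varepsilon)^q}$ for all integers $p,q$ with $q\ge q(\varepsilon)$; if no such $\beta$ exists, $\beta(\alpha)=\infty$. Conventions: $b_0$ is an integer, $b_1,b_2,\ldots$ are positive integers, and $[b_0;b_1,b_2,\ldots]=b_0+\cfrac{1}{b_1+\cfrac{1}{b_2+\cdots}}$. The condition $b_n=e^{o(g(n))}$ means $\ln b_n/g(n)\to0$ as $n\to\infty$ (a condition on the $b_n$ with $n\ge1$). The Fibonacci numbers are indexed by $F_1=1$, $F_2=2$, $F_{n+1}=F_n+F_{n-1}$.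 *)

theory Defs
  imports Complex_Main "HOL-Library.Extended_Real" "HOL-Number_Theory.Fib"
    "HOL-Computational_Algebra.Polynomial"
begin

text \<open>
  The two admissible sets below are upward closed and closed under decreasing limits, because of the
  quantification over \<open>\<epsilon>\<close>.  For irrational \<open>\<alpha>\<close> the first one is moreover bounded
  away from \<open>0\<close> (Dirichlet), so \<open>LEAST\<close> is well defined whenever the set is nonempty.  For
  rational \<open>\<alpha>\<close> both sets are empty and the values are \<open>\<infinity>\<close>.
\<close>

definition exponent_admissible :: "real \<Rightarrow> real \<Rightarrow> bool" where
  "exponent_admissible \<alpha> \<mu> \<longleftrightarrow>
     (\<forall>\<epsilon>>0. \<exists>Q::nat. Q > 0 \<and>
        (\<forall>(p::int) (q::nat). q \<ge> Q \<longrightarrow> \<bar>\<alpha> - of_int p / real q\<bar> > real q powr (- (\<mu> + \<epsilon>))))"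

definition irrationality_exponent :: "real \<Rightarrow> ereal" where
  "irrationality_exponent \<alpha> =
     (if \<exists>\<mu>>0. exponent_admissible \<alpha> \<mu>
      then ereal (LEAST \<mu>. \<mu> > 0 \<and> exponent_admissible \<alpha> \<mu>) else \<infinity>)"

definition base_admissible :: "real \<Rightarrow> real \<Rightarrow> bool" where
  "base_admissible \<alpha> \<beta> \<longleftrightarrow>
     (\<forall>\<epsilon>>0. \<exists>Q::nat. Q > 0 \<and>
        (\<forall>(p::int) (q::nat). q \<ge> Q \<longrightarrow> \<bar>\<alpha> - of_int p / real q\<bar> > 1 / (\<beta> + \<epsilon>) ^ q))"

definition irrationality_base :: "real \<Rightarrow> ereal" where
  "irrationality_base \<alpha> =
     (if \<exists>\<beta>\<ge>1. base_admissible \<alpha> \<beta>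
      then ereal (LEAST \<beta>. \<beta> \<ge> 1 \<and> base_admissible \<alpha> \<beta>) else \<infinity>)"

text \<open>\<open>finite_cf b n\<close> is the finite continued fraction \<open>[b 0; b 1, \<dots>, b n]\<close>.\<close>

fun finite_cf :: "(nat \<Rightarrow> int) \<Rightarrow> nat \<Rightarrow> real" where
  "finite_cf b 0 = of_int (b 0)"
| "finite_cf b (Suc n) = of_int (b 0) + 1 / finite_cf (\<lambda>k. b (Suc k)) n"

definition simple_cf_expansion :: "(nat \<Rightarrow> int) \<Rightarrow> real \<Rightarrow> bool" where
  "simple_cf_expansion b \<alpha> \<longleftrightarrow> (\<forall>n\<ge>1. b n > 0) \<and> finite_cf b \<longlonglongrightarrow> \<alpha>"

text \<open>
  \<open>b\<^sub>n = e\<^bsup>o(g(n))\<^esup>\<close>.  For the Fibonacci numbers indexed by \<open>F\<^sub>1 = 1\<close>, \<open>F\<^sub>2 = 2\<close>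
  one has \<open>F\<^sub>n = fib (n + 1)\<close>, since the library has \<open>fib 1 = fib 2 = 1\<close>.
\<close>

definition exp_little_o :: "(nat \<Rightarrow> int) \<Rightarrow> (nat \<Rightarrow> real) \<Rightarrow> bool" where
  "exp_little_o b g \<longleftrightarrow> (\<lambda>n. ln (real_of_int (b n)) / g n) \<longlonglongrightarrow> 0"

end

theory Submission
  imports Defs "HOL-Real_Asymp.Real_Asymp"
begin

text \<open>
  Let \<open>p\<^sub>n / q\<^sub>n\<close> be the convergents.  By best approximation, every fraction \<open>p / q\<close> with
  \<open>q\<^sub>n \<le> q < q\<^sub>n\<^sub>+\<^sub>1\<close> satisfies \<open>\<bar>q \<alpha> - p\<bar> \<ge> \<bar>q\<^sub>n \<alpha> - p\<^sub>n\<bar> \<ge> 1 / (2 q\<^sub>n\<^sub>+\<^sub>1)\<close>, so everything depends on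
  how far \<open>q\<^sub>n\<^sub>+\<^sub>1\<close> exceeds \<open>q\<^sub>n\<close>.  As \<open>q\<^sub>n\<close> grows at least like the Fibonacci numbers and
  \<open>q\<^sub>n\<^sub>+\<^sub>1 \<le> 2 b\<^sub>n\<^sub>+\<^sub>1 q\<^sub>n\<close>, the first growth condition gives \<open>q\<^sub>n\<^sub>+\<^sub>1 \<le> q\<^sub>n\<^bsup>1 + o(1)\<^esup>\<close>, and the second one,
  summed over the indices up to \<open>n + 1\<close>, gives \<open>ln q\<^sub>n\<^sub>+\<^sub>1 = o(q\<^sub>n)\<close>.  The lower bound
  \<open>\<mu> \<ge> 2\<close> comes from the convergents themselves.
\<close>

section \<open>Convergents\<close>

text \<open>The index is shifted by one: the convergent of index \<open>n\<close> is
  \<open>cf_num b (Suc n) / cf_den b (Suc n)\<close>, and index \<open>0\<close> is the formal fraction \<open>1 / 0\<close>.\<close>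

fun cf_num :: "(nat \<Rightarrow> int) \<Rightarrow> nat \<Rightarrow> int" where
  "cf_num b 0 = 1"
| "cf_num b (Suc 0) = b 0"
| "cf_num b (Suc (Suc n)) = b (Suc n) * cf_num b (Suc n) + cf_num b n"

fun cf_den :: "(nat \<Rightarrow> int) \<Rightarrow> nat \<Rightarrow> int" where
  "cf_den b 0 = 0"
| "cf_den b (Suc 0) = 1"
| "cf_den b (Suc (Suc n)) = b (Suc n) * cf_den b (Suc n) + cf_den b n"

text \<open>\<open>finite_cf\<close> peels off the first partial quotient, while
  \<open>cf_num\<close> and \<open>cf_den\<close> append the last one. This rule and
  \<open>cf_den_shift\<close> reconcile the two by expanding the same product of 2x2 matrices from
  the left.\<close>

lemma cf_num_shift:
  "cf_num b (Suc n) = b 0 * cf_num (\<lambda>k. b (Suc k)) n + cf_den (\<lambda>k. b (Suc k)) n"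
  by (induction b n rule: cf_num.induct) (auto simp: algebra_simps)

lemma cf_den_shift: "cf_den b (Suc n) = cf_num (\<lambda>k. b (Suc k)) n"
  by (induction b n rule: cf_num.induct) auto

lemma cf_den_ge_fib:
  assumes "\<forall>n\<ge>1. b n > 0"
  shows "int (fib n) \<le> cf_den b n"
proof (induction n rule: fib.induct)
  case (3 n)
  have "b (Suc n) \<ge> 1" using assms[rule_format, of "Suc n"] by simp
  moreover have "cf_den b (Suc n) \<ge> 0" using 3 by linarith
  ultimately have "cf_den b (Suc n) \<le> b (Suc n) * cf_den b (Suc n)"
    by (simp add: mult_le_cancel_right1)
  with 3 show ?case by simp
qed auto

lemma cf_den_pos:
  assumes "\<forall>n\<ge>1. b n > 0" "n > 0"
  shows "cf_den b n > 0"
  using cf_den_ge_fib[OF assms(1), of n] fib_neq_0_nat[OF assms(2)] by linarith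

lemma finite_cf_eq:
  assumes "\<forall>n\<ge>1. b n > 0"
  shows "finite_cf b n = of_int (cf_num b (Suc n)) / of_int (cf_den b (Suc n))"
  using assms
proof (induction n arbitrary: b)
  case (Suc n)
  \<comment> \<open>The reciprocal of the tail requires its numerator to be nonzero; that numerator
    is a denominator of \<open>b\<close> itself, hence positive.\<close>
  have "cf_num (\<lambda>k. b (Suc k)) (Suc n) > 0"
    using cf_den_pos[OF Suc.prems, of "Suc (Suc n)"] by (simp only: cf_den_shift)
  moreover have "finite_cf (\<lambda>k. b (Suc k)) n =
      of_int (cf_num (\<lambda>k. b (Suc k)) (Suc n)) / of_int (cf_den (\<lambda>k. b (Suc k)) (Suc n))"
    using Suc.prems by (intro Suc.IH) auto
  ultimately show ?case
    by (simp add: cf_num_shift[of b "Suc n"] cf_den_shift[of b "Suc n"] field_simps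
             del: cf_num.simps cf_den.simps)
qed simp

text \<open>8/5 lies below the golden ratio, as (8/5)^2 \<le> 8/5 + 1, and above 3/2, which matters
  for the bound exp((3/2)^n). Since \<open>fib 0 = 0\<close> violates the estimate,
  \<open>fib 2\<close> is checked directly.\<close>

lemma fib_ge_power:
  assumes "n > 0"
  shows "(8 / 5) ^ n / 4 \<le> real (fib n)"
  using assms
proof (induction n rule: fib.induct)
  case (3 n)
  show ?case
  proof (cases "n = 0")
    case False
    have "(8 / 5 :: real) ^ Suc (Suc n) \<le> (8 / 5) ^ Suc n + (8 / 5) ^ n"
      by simp
    moreover have "(8 / 5) ^ n / 4 \<le> real (fib n)" "(8 / 5) ^ Suc n / 4 \<le> real (fib (Suc n))"
      using 3 False by auto
    ultimately show ?thesis unfolding fib.simps of_nat_add by linarith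
  qed (simp add: power2_eq_square)
qed auto

section \<open>Approximation by convergents\<close>

locale irrational_cf =
  fixes b :: "nat \<Rightarrow> int" and \<alpha> :: real
  assumes irrational: "\<alpha> \<notin> \<rat>"
    and expansion: "simple_cf_expansion b \<alpha>"
begin

abbreviation p :: "nat \<Rightarrow> int" where "p \<equiv> cf_num b"
abbreviation q :: "nat \<Rightarrow> int" where "q \<equiv> cf_den b"

text \<open>Convergents lie alternately on either side of \<alpha>; the sign turns
  \<open>err n\<close> into the absolute value of q_n \<alpha> - p_n (see \<open>abs_err\<close>)
  while keeping it linear, so that recurrences stay exact.\<close>

definition err :: "nat \<Rightarrow> real" where
  "err n = (-1) ^ Suc n * (of_int (q n) * \<alpha> - of_int (p n))"

section \<open>Monotonicity and growth of the denominators\<close>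

lemma b_pos: "\<forall>n\<ge>1. b n > 0"
  using expansion by (simp add: simple_cf_expansion_def)

lemma b_ge_1: "b (Suc n) \<ge> 1"
  using b_pos[rule_format, of "Suc n"] by simp

lemma q_pos: "n > 0 \<Longrightarrow> q n > 0"
  using cf_den_pos[OF b_pos] .

lemma q_nonneg: "q n \<ge> 0"
  using q_pos[of n] by (cases n) auto

lemma q_Suc_mono: "q n \<le> q (Suc n)"
proof (cases n)
  case (Suc k)
  have "q (Suc k) \<le> b (Suc k) * q (Suc k)"
    using b_ge_1[of k] q_nonneg[of "Suc k"] by (simp add: mult_le_cancel_right1)
  then show ?thesis using q_nonneg[of k] by (simp add: Suc)
qed simp

lemma q_mono: "m \<le> n \<Longrightarrow> q m \<le> q n"
  by (rule lift_Suc_mono_le[of q]) (rule q_Suc_mono)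

lemma q_Suc_le: "n > 0 \<Longrightarrow> q (Suc n) \<le> 2 * b n * q n"
proof (cases n)
  case (Suc k)
  have "q k \<le> q (Suc k)" by (rule q_Suc_mono)
  also have "q (Suc k) \<le> b (Suc k) * q (Suc k)"
    using b_ge_1[of k] q_nonneg[of "Suc k"] by (simp add: mult_le_cancel_right1)
  finally show ?thesis by (simp add: Suc)
qed simp

lemma q_ge_power: "n > 0 \<Longrightarrow> (8 / 5) ^ n / 4 \<le> real_of_int (q n)"
  using fib_ge_power[of n] cf_den_ge_fib[OF b_pos, of n] by linarith

lemma q_at_top: "filterlim (\<lambda>n. real_of_int (q n)) at_top sequentially"
proof (rule filterlim_at_top_mono)
  show "filterlim (\<lambda>n. (8 / 5 :: real) ^ n / 4) at_top sequentially" by real_asymp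
  show "\<forall>\<^sub>F n in sequentially. (8 / 5) ^ n / 4 \<le> real_of_int (q n)"
    using eventually_gt_at_top[of 0] by eventually_elim (rule q_ge_power)
qed

section \<open>Signs and sizes of the approximation errors\<close>

lemma determinant: "q n * p (Suc n) - p n * q (Suc n) = (-1) ^ Suc n"
  by (induction n) (auto simp: algebra_simps)

text \<open>In \<open>k\<close> the expression obeys the recurrence of the convergents, with
  positive coefficients and initial values 0 and 1 (the determinant); \<open>fib.induct\<close>
  merely supplies two-step induction.\<close>

lemma cross_nonneg: "(-1) ^ Suc n * (q n * p (n + k) - p n * q (n + k)) \<ge> 0"
proof (induction k rule: fib.induct)
  case 2
  then show ?case using determinant[of n] by (simp flip: power_mult_distrib)
next
  case (3 k)
  have "(-1) ^ Suc n * (q n * p (n + Suc (Suc k)) - p n * q (n + Suc (Suc k)))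
    = b (Suc (n + k)) * ((-1) ^ Suc n * (q n * p (n + Suc k) - p n * q (n + Suc k)))
      + (-1) ^ Suc n * (q n * p (n + k) - p n * q (n + k))"
    by (simp add: algebra_simps)
  also have "\<dots> \<ge> 0"
    using b_ge_1[of "n + k"] 3 by (intro add_nonneg_nonneg mult_nonneg_nonneg[of "b (Suc (n + k))"]) linarith+
  finally show ?case .
qed simp

text \<open>Replacing \<alpha> by a later convergent gives a nonnegative value by
  \<open>cross_nonneg\<close>, and this survives the limit. Irrationality excludes zero, except at
  index 0, where \<open>err 0 = 1\<close> by computation.\<close>

lemma err_pos: "err n > 0"
proof -
  have lim: "(\<lambda>m. (-1) ^ Suc n * (of_int (q n) * finite_cf b m - of_int (p n))) \<longlonglongrightarrow> err n"
    using expansion unfolding err_def simple_cf_expansion_def by (auto intro!: tendsto_intros)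
  have "(-1) ^ Suc n * (of_int (q n) * finite_cf b m - of_int (p n)) \<ge> 0"
    if "m \<ge> n" for m
  proof -
    define D where "D = (-1) ^ Suc n * (q n * p (Suc m) - p n * q (Suc m))"
    have "D \<ge> 0"
      using cross_nonneg[of n "Suc m - n"] that by (simp add: D_def)
    moreover have "q (Suc m) > 0" by (rule q_pos) simp
    moreover have "(-1) ^ Suc n * (of_int (q n) * finite_cf b m - of_int (p n))
        = real_of_int D / of_int (q (Suc m))"
      using \<open>q (Suc m) > 0\<close> unfolding D_def
      by (simp add: finite_cf_eq[OF b_pos] field_simps del: cf_num.simps cf_den.simps)
    ultimately show ?thesis by simp
  qed
  then have "err n \<ge> 0"
    by (rule tendsto_lowerbound[OF lim eventually_sequentiallyI]) simp_all
  moreover have "err n \<noteq> 0"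
  proof (cases "n = 0")
    case False
    then have "q n > 0" by (intro q_pos) simp
    show ?thesis
    proof
      assume "err n = 0"
      then have "\<alpha> = of_int (p n) / of_int (q n)"
        using \<open>q n > 0\<close> by (simp add: err_def field_simps)
      with irrational show False by auto
    qed
  qed (simp add: err_def)
  ultimately show ?thesis by linarith
qed

lemma err_rec: "err (Suc (Suc n)) = err n - of_int (b (Suc n)) * err (Suc n)"
  by (simp add: err_def algebra_simps)

lemma err_Suc_le: "err (Suc n) \<le> err n"
proof -
  have "err (Suc n) \<le> of_int (b (Suc n)) * err (Suc n)"
    using b_ge_1[of n] err_pos[of "Suc n"] by (simp add: mult_le_cancel_right1)
  then show ?thesis using err_rec[of n] err_pos[of "Suc (Suc n)"] by linarith
qed

text \<open>The terms with \<alpha> cancel and leave the determinant. Two nonnegative summands add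
  up to 1: the first is the larger, hence at least 1/2 (\<open>err_lower\<close>), and at most 1
  (\<open>err_upper\<close>).\<close>

lemma err_identity: "err n * of_int (q (Suc n)) + err (Suc n) * of_int (q n) = 1"
proof -
  have "err n * of_int (q (Suc n)) + err (Suc n) * of_int (q n)
     = (-1) ^ Suc n * real_of_int (q n * p (Suc n) - p n * q (Suc n))"
    by (simp add: err_def algebra_simps del: cf_num.simps cf_den.simps)
  also have "\<dots> = 1"
    unfolding determinant by (simp flip: power_mult_distrib)
  finally show ?thesis .
qed

lemma err_lower: "1 / (2 * real_of_int (q (Suc n))) \<le> err n"
proof -
  have "err (Suc n) * of_int (q n) \<le> err n * of_int (q (Suc n))"
    using err_Suc_le[of n] q_Suc_mono[of n] err_pos[of n] q_nonneg[of n] by (intro mult_mono) auto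
  then have "1 \<le> err n * (2 * of_int (q (Suc n)))"
    using err_identity[of n] by linarith
  then show ?thesis using q_pos[of "Suc n"] by (simp add: field_simps del: cf_den.simps)
qed

lemma err_upper: "err n * of_int (q n) \<le> 1"
proof -
  have "err n * of_int (q n) \<le> err n * of_int (q (Suc n))"
    using err_pos[of n] q_Suc_mono[of n] by (intro mult_left_mono) auto
  moreover have "err (Suc n) * of_int (q n) \<ge> 0"
    using err_pos[of "Suc n"] q_nonneg[of n] by (intro mult_nonneg_nonneg) auto
  ultimately show ?thesis using err_identity[of n] by linarith
qed

lemma abs_err: "\<bar>of_int (q n) * \<alpha> - of_int (p n)\<bar> = err n"
proof -
  have "\<bar>err n\<bar> = \<bar>of_int (q n) * \<alpha> - of_int (p n)\<bar>" by (simp add: err_def abs_mult)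
  then show ?thesis using err_pos[of n] by simp
qed

text \<open>Lagrange's argument: by the determinant, two consecutive convergents form a basis of the
  integer lattice, so the pair (s, r) has integer coordinates \<open>x\<close>, \<open>y\<close> in
  it, and the error splits accordingly.\<close>

lemma best_approximation:
  fixes r s :: int
  assumes "0 < s" "s < q (Suc n)"
  shows "err n \<le> \<bar>of_int s * \<alpha> - of_int r\<bar>"
proof -
  define \<sigma> :: int where "\<sigma> = (-1) ^ Suc n"
  \<comment> \<open>Cramer's rule; division by the determinant \<sigma> = 1 or -1 is multiplication
    by it.\<close>
  define x where "x = \<sigma> * (s * p (Suc n) - r * q (Suc n))"
  define y where "y = \<sigma> * (r * q n - s * p n)"
  have sq: "\<sigma> * \<sigma> = 1" by (simp add: \<sigma>_def flip: power_mult_distrib)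
  have det: "q n * p (Suc n) - p n * q (Suc n) = \<sigma>" using determinant by (simp add: \<sigma>_def)
  have "x * q n + y * q (Suc n) = \<sigma> * (s * (q n * p (Suc n) - p n * q (Suc n)))"
    by (simp add: x_def y_def algebra_simps del: cf_num.simps cf_den.simps)
  then have s: "s = x * q n + y * q (Suc n)" using sq by (simp add: det)
  have "x * p n + y * p (Suc n) = \<sigma> * (r * (q n * p (Suc n) - p n * q (Suc n)))"
    by (simp add: x_def y_def algebra_simps del: cf_num.simps cf_den.simps)
  then have r: "r = x * p n + y * p (Suc n)" using sq by (simp add: det)
  have "of_int s * \<alpha> - of_int r = of_int x * (of_int (q n) * \<alpha> - of_int (p n))
      + of_int y * (of_int (q (Suc n)) * \<alpha> - of_int (p (Suc n)))"
    unfolding s r by (simp add: algebra_simps del: cf_num.simps cf_den.simps)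
  also have "\<dots> = (-1) ^ Suc n * (of_int x * err n - of_int y * err (Suc n))"
    by (simp add: err_def algebra_simps flip: power_mult_distrib del: cf_num.simps cf_den.simps)
  finally have eq: "\<bar>of_int s * \<alpha> - of_int r\<bar> = \<bar>of_int x * err n - of_int y * err (Suc n)\<bar>"
    by (simp add: abs_mult)
  have e: "err n > 0" "err (Suc n) > 0" by (rule err_pos)+
  \<comment> \<open>Since \<open>0 < s < q (Suc n)\<close>, the coefficients have opposite signs, so nothing cancels in \<open>eq\<close>.\<close>
  have "x \<ge> 1 \<and> y \<le> 0 \<or> x \<le> - 1 \<and> y \<ge> 0"
  proof (rule ccontr)
    assume "\<not> ?thesis"
    then consider "x \<ge> 0" "y \<ge> 1" | "x \<le> 0" "y \<le> 0"
      by linarith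
    then show False
    proof cases
      case 2
      then have "x * q n \<le> 0" "y * q (Suc n) \<le> 0"
        using q_nonneg by (auto simp: mult_nonpos_nonneg simp del: cf_den.simps)
      then show False using assms(1) s by linarith
    next
      case 1
      then have "x * q n \<ge> 0" "y * q (Suc n) \<ge> 1 * q (Suc n)"
        using q_nonneg by (intro mult_nonneg_nonneg mult_right_mono; simp del: cf_den.simps)+
      then show False using assms(2) s by linarith
    qed
  qed
  then have "err n \<le> \<bar>of_int x * err n - of_int y * err (Suc n)\<bar>"
  proof (elim disjE conjE)
    assume "x \<ge> 1" "y \<le> 0"
    then have "1 * err n \<le> of_int x * err n" "of_int y * err (Suc n) \<le> 0"
      using e by (intro mult_right_mono mult_nonpos_nonneg; simp)+
    then show ?thesis by linarith
  next
    assume "x \<le> -1" "y \<ge> 0"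
    then have "1 * err n \<le> of_int (- x) * err n" "of_int y * err (Suc n) \<ge> 0"
      using e by (intro mult_right_mono mult_nonneg_nonneg; simp)+
    then show ?thesis by simp
  qed
  then show ?thesis using eq by simp
qed

text \<open>Each \<open>s\<close> lies in a window q_n \<le> s < q_(n+1), where
  \<open>best_approximation\<close> and \<open>err_lower\<close> apply. The parameter
  \<open>N\<close> allows estimates valid only for large indices to be used once \<open>s\<close> is
  large.\<close>

lemma approximation_lower_bound:
  "\<forall>\<^sub>F s in sequentially. \<exists>n\<ge>N. q n \<le> int s \<and>
     (\<forall>r::int. 1 / (2 * real s * of_int (q (Suc n))) \<le> \<bar>\<alpha> - of_int r / real s\<bar>)"
proof -
  have "\<exists>n\<ge>N. q n \<le> int s \<and>
     (\<forall>r::int. 1 / (2 * real s * of_int (q (Suc n))) \<le> \<bar>\<alpha> - of_int r / real s\<bar>)"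
    if s: "s \<ge> nat (q (Suc N))" for s
  proof -
    have "q (Suc N) > 0" by (rule q_pos) simp
    with s have "s > 0" by linarith
    have "\<exists>n. real s < of_int (q n)"
      using eventually_happens[OF filterlim_at_top_dense[THEN iffD1, OF q_at_top, rule_format, of "real s"]]
      by auto
    then have ex: "\<exists>n. int s < q n" by (metis of_int_less_iff of_int_of_nat_eq)
    \<comment> \<open>The least such index is a successor because \<open>q 0 = 0\<close>; its
      predecessor is the index of the window.\<close>
    define m where "m = (LEAST n. int s < q n)"
    have m: "int s < q m" unfolding m_def using ex by (rule LeastI_ex)
    then obtain n where n: "m = Suc n" using \<open>s > 0\<close> by (cases m) auto
    have "q n \<le> int s"
      using not_less_Least[of n "\<lambda>n. int s < q n"] n by (auto simp: m_def[symmetric])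
    moreover have "n \<ge> N"
    proof (rule ccontr)
      assume "\<not> n \<ge> N"
      then have "q m \<le> q (Suc N)" using n by (intro q_mono) simp
      with m s show False by linarith
    qed
    moreover have "1 / (2 * real s * of_int (q (Suc n))) \<le> \<bar>\<alpha> - of_int r / real s\<bar>" for r :: int
    proof -
      have "1 / (2 * real s * of_int (q (Suc n))) = 1 / (2 * of_int (q (Suc n))) / real s"
        by simp
      also have "\<dots> \<le> err n / real s"
        by (intro divide_right_mono err_lower) simp
      also have "\<dots> \<le> \<bar>of_int (int s) * \<alpha> - of_int r\<bar> / real s"
        using \<open>s > 0\<close> m n by (intro divide_right_mono best_approximation) auto
      also have "\<dots> = \<bar>(of_int (int s) * \<alpha> - of_int r) / real s\<bar>"
        by (simp add: abs_divide)
      also have "(of_int (int s) * \<alpha> - of_int r) / real s = \<alpha> - of_int r / real s"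
        using \<open>s > 0\<close> by (simp add: field_simps)
      finally show ?thesis .
    qed
    ultimately show ?thesis by blast
  qed
  then show ?thesis by (auto simp: eventually_at_top_linorder)
qed

end

section \<open>Irrationality exponent and base\<close>

lemma eventually_sequentially_pos:
  "(\<forall>\<^sub>F s in sequentially. P s) \<longleftrightarrow> (\<exists>Q::nat>0. \<forall>s\<ge>Q. P s)"
  unfolding eventually_sequentially by (metis Suc_leD zero_less_Suc)

lemma exp_little_o_eventually_le:
  assumes "exp_little_o b g" "\<forall>\<^sub>F n in sequentially. g n > 0" "\<delta> > 0"
  shows "\<forall>\<^sub>F n in sequentially. ln (real_of_int (b n)) \<le> \<delta> * g n"
proof -
  have "\<forall>\<^sub>F n in sequentially. ln (real_of_int (b n)) / g n < \<delta>"
    using assms(1,3) unfolding exp_little_o_def by (rule order_tendstoD)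
  with assms(2) show ?thesis
    by eventually_elim (simp add: field_simps)
qed

section \<open>Admissible exponents and bases from the convergents\<close>

context irrational_cf
begin

text \<open>With \<epsilon> = 2 - \<mu> the required lower bound is exactly 1/q^2, which a
  convergent with large denominator violates by \<open>err_upper\<close>.\<close>

lemma exponent_admissible_ge_2:
  assumes "exponent_admissible \<alpha> \<mu>"
  shows "\<mu> \<ge> 2"
proof (rule ccontr)
  assume "\<not> \<mu> \<ge> 2"
  then have "2 - \<mu> > 0" by simp
  with assms obtain Q :: nat where
    Q: "\<And>(r::int) (s::nat). s \<ge> Q \<Longrightarrow> \<bar>\<alpha> - of_int r / real s\<bar> > real s powr (- (\<mu> + (2 - \<mu>)))"
    unfolding exponent_admissible_def by blast
  have "\<forall>\<^sub>F n in sequentially. real_of_int (q n) \<ge> real Q"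
    using filterlim_at_top[THEN iffD1, OF q_at_top] by blast
  then have "\<forall>\<^sub>F n in sequentially. real_of_int (q n) \<ge> real Q \<and> n > 0"
    using eventually_gt_at_top[of "0::nat"] by eventually_elim auto
  then obtain n where n: "real_of_int (q n) \<ge> real Q" "n > 0"
    by (auto dest: eventually_happens)
  then have "q n > 0" by (intro q_pos)
  define s where "s = nat (q n)"
  have s: "real s = of_int (q n)" "s > 0" using \<open>q n > 0\<close> by (auto simp: s_def)
  have "Q \<le> s" using n(1) s by linarith
  then have "1 / real s ^ 2 < \<bar>\<alpha> - of_int (p n) / real s\<bar>"
    using Q[of s "p n"] s(2) by (simp add: powr_minus divide_simps)
  also have "\<alpha> - of_int (p n) / real s = (of_int (q n) * \<alpha> - of_int (p n)) / real s"
    using s by (simp add: field_simps)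
  also have "\<bar>\<dots>\<bar> = err n / real s"
    using abs_err[of n] by (simp add: abs_divide)
  finally have "1 < err n * of_int (q n)"
    using s by (simp add: field_simps power2_eq_square)
  then show False using err_upper[of n] by linarith
qed

lemma exponent_admissible_2:
  assumes "exp_little_o b (\<lambda>n. real n)"
  shows "exponent_admissible \<alpha> 2"
  unfolding exponent_admissible_def
proof (intro allI impI)
  fix \<epsilon> :: real assume "\<epsilon> > 0"
  \<comment> \<open>By \<open>q_ge_power\<close>, \<epsilon> ln q_n is at least 2 \<delta> n -
    \<epsilon> ln 4. One \<delta> n pays for ln b_n, the other for the constants ln 4 and \<epsilon>
    ln 4.\<close>
  define \<delta> where "\<delta> = \<epsilon> * ln (8 / 5) / 2"
  have "\<delta> > 0" using \<open>\<epsilon> > 0\<close> by (simp add: \<delta>_def)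
  have "\<forall>\<^sub>F n in sequentially. ln (real_of_int (b n)) \<le> \<delta> * real n"
    using assms eventually_gt_at_top[of "0::nat"] \<open>\<delta> > 0\<close>
    by (intro exp_little_o_eventually_le) (auto elim: eventually_mono)
  moreover have "\<forall>\<^sub>F n in sequentially. ln 4 * (1 + \<epsilon>) < \<delta> * real n"
    using \<open>\<delta> > 0\<close> by real_asymp
  \<comment> \<open>The 4 combines the factor 2 of \<open>approximation_lower_bound\<close> with the
    factor 2 of \<open>q_Suc_le\<close>.\<close>
  ultimately have "\<forall>\<^sub>F n in sequentially. n > 0 \<and>
      4 * real_of_int (b n) < real_of_int (q n) powr \<epsilon>"
    using eventually_gt_at_top[of "0::nat"]
  proof eventually_elim
    case (elim n)
    have b: "b n > 0" using b_pos elim by auto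
    have q: "q n > 0" using elim by (intro q_pos)
    have "real n * ln (8 / 5) - ln 4 = ln ((8 / 5) ^ n / 4)"
      by (simp add: ln_div ln_realpow)
    also have "\<dots> \<le> ln (real_of_int (q n))"
      using q_ge_power[OF elim(3)] q by (subst ln_le_cancel_iff) auto
    finally have "\<epsilon> * (real n * ln (8 / 5) - ln 4) \<le> \<epsilon> * ln (real_of_int (q n))"
      using \<open>\<epsilon> > 0\<close> by (intro mult_left_mono) auto
    moreover have "\<epsilon> * (real n * ln (8 / 5) - ln 4) = 2 * (\<delta> * real n) - \<epsilon> * ln 4"
      by (simp add: \<delta>_def algebra_simps)
    moreover have "ln 4 * (1 + \<epsilon>) = ln 4 + \<epsilon> * ln 4" by (simp add: algebra_simps)
    ultimately have "ln 4 + ln (real_of_int (b n)) < \<epsilon> * ln (real_of_int (q n))"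
      using elim by linarith
    then have "ln (4 * real_of_int (b n)) < ln (real_of_int (q n) powr \<epsilon>)"
      using b q by (simp add: ln_mult ln_powr)
    then show ?case using b q elim by (subst (asm) ln_less_cancel_iff) auto
  qed
  then obtain N where N: "\<And>n. n \<ge> N \<Longrightarrow> n > 0 \<and>
      4 * real_of_int (b n) < real_of_int (q n) powr \<epsilon>"
    by (auto simp: eventually_sequentially)
  have "\<forall>\<^sub>F s in sequentially. \<forall>r::int. \<bar>\<alpha> - of_int r / real s\<bar> > real s powr (- (2 + \<epsilon>))"
    using approximation_lower_bound[of N] eventually_gt_at_top[of "0::nat"]
  proof eventually_elim
    case (elim s)
    then obtain n where n: "n \<ge> N" "q n \<le> int s"
      "\<And>r::int. 1 / (2 * real s * of_int (q (Suc n))) \<le> \<bar>\<alpha> - of_int r / real s\<bar>" by blast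
    have "n > 0" using N n by auto
    have b: "real_of_int (b n) > 0" using b_pos \<open>n > 0\<close> by auto
    have q: "real_of_int (q n) > 0" using q_pos[OF \<open>n > 0\<close>] by simp
    have q': "real_of_int (q (Suc n)) > 0" using q_pos[of "Suc n"] by simp
    have qs: "real_of_int (q n) \<le> real s" using n(2) by linarith
    have "real_of_int (q (Suc n)) \<le> 2 * real_of_int (b n) * real_of_int (q n)"
      using q_Suc_le[OF \<open>n > 0\<close>] by (metis of_int_le_iff of_int_mult of_int_numeral)
    also have "\<dots> \<le> 2 * real_of_int (b n) * real s"
      using qs b by (intro mult_left_mono) auto
    finally have "2 * real s * of_int (q (Suc n)) \<le> 2 * real s * (2 * real_of_int (b n) * real s)"
      by (intro mult_left_mono) auto
    also have "\<dots> = real s ^ 2 * (4 * real_of_int (b n))" by (simp add: power2_eq_square)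
    also have "\<dots> < real s ^ 2 * real_of_int (q n) powr \<epsilon>"
      using N[OF n(1)] elim(2) by (intro mult_strict_left_mono) auto
    also have "\<dots> \<le> real s ^ 2 * real s powr \<epsilon>"
      using qs q \<open>\<epsilon> > 0\<close> by (intro mult_left_mono powr_mono2) auto
    also have "\<dots> = real s powr (2 + \<epsilon>)"
      using elim(2) by (simp add: powr_add)
    finally have "1 / real s powr (2 + \<epsilon>) < 1 / (2 * real s * of_int (q (Suc n)))"
      using q' elim(2) by (intro divide_strict_left_mono mult_pos_pos) auto
    moreover have "real s powr (- (2 + \<epsilon>)) = 1 / real s powr (2 + \<epsilon>)"
      by (simp only: powr_minus inverse_eq_divide)
    ultimately show ?case using n(3) by (metis less_le_trans)
  qed
  then show "\<exists>Q::nat. Q > 0 \<and>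
        (\<forall>(r::int) (s::nat). s \<ge> Q \<longrightarrow> \<bar>\<alpha> - of_int r / real s\<bar> > real s powr (- (2 + \<epsilon>)))"
    unfolding eventually_sequentially_pos by blast
qed

text \<open>Iterating \<open>q_Suc_le\<close> costs ln 2 and one Fibonacci term per step. The index
  n + 3 makes the bound reproduce itself, since fib(n+2) + fib(n+3) = fib(n+4).\<close>

lemma ln_cf_den_le:
  assumes "\<And>n. n \<ge> N \<Longrightarrow> ln (real_of_int (b n)) \<le> \<delta> * real (fib (n + 1))" "\<delta> \<ge> 0" "n \<ge> N"
  shows "ln (real_of_int (q (Suc n))) \<le>
      ln (real_of_int (q (Suc N))) + real n * ln 2 + \<delta> * real (fib (n + 3))"
  using assms(3)
proof (induction n rule: dec_induct)
  case base
  then show ?case using \<open>\<delta> \<ge> 0\<close> by simp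
next
  case (step n)
  have b: "real_of_int (b (Suc n)) > 0" using b_ge_1[of n] by simp
  have q: "real_of_int (q (Suc n)) > 0" "real_of_int (q (Suc (Suc n))) > 0"
    using q_pos[of "Suc n"] q_pos[of "Suc (Suc n)"] by (auto simp del: cf_den.simps)
  have "real_of_int (q (Suc (Suc n))) \<le> 2 * real_of_int (b (Suc n)) * real_of_int (q (Suc n))"
    using q_Suc_le[of "Suc n"] by (metis of_int_le_iff of_int_mult of_int_numeral zero_less_Suc)
  then have "ln (real_of_int (q (Suc (Suc n)))) \<le>
      ln (2 * real_of_int (b (Suc n)) * real_of_int (q (Suc n)))"
    using q b by (subst ln_le_cancel_iff) auto
  also have "\<dots> = ln 2 + ln (real_of_int (b (Suc n))) + ln (real_of_int (q (Suc n)))"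
    using q b by (simp add: ln_mult del: cf_den.simps)
  also have "\<dots> \<le> ln 2 + \<delta> * real (fib (Suc n + 1)) + (ln (real_of_int (q (Suc N)))
      + real n * ln 2 + \<delta> * real (fib (n + 3)))"
    using step assms(1)[of "Suc n"] by (intro add_mono) auto
  also have "\<dots> = ln (real_of_int (q (Suc N))) + real (Suc n) * ln 2 + \<delta> * real (fib (Suc n + 3))"
    by (simp add: algebra_simps eval_nat_numeral del: cf_den.simps)
  finally show ?case .
qed

text \<open>For positive n, fib(n+3) = 3 fib(n) + 2 fib(n-1).\<close>

lemma fib_add_3_le: "n > 0 \<Longrightarrow> fib (n + 3) \<le> 5 * fib n"
  using fib_mono[of "n - 1" n] by (cases n) (auto simp: eval_nat_numeral)

lemma base_admissible_1:
  assumes "exp_little_o b (\<lambda>n. real (fib (n + 1)))"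
  shows "base_admissible \<alpha> 1"
  unfolding base_admissible_def
proof (intro allI impI)
  fix \<epsilon> :: real assume "\<epsilon> > 0"
  \<comment> \<open>Budget in multiples of \<delta>: five for fib(n+3) \<le> 5 fib(n), one for the
    linear term C + n ln 2, one for ln(2s). These seven stay below the eight that make up ln(1 +
    \<epsilon>).\<close>
  define \<delta> where "\<delta> = ln (1 + \<epsilon>) / 8"
  have "\<delta> > 0" using \<open>\<epsilon> > 0\<close> by (simp add: \<delta>_def)
  have "\<forall>\<^sub>F n in sequentially. ln (real_of_int (b n)) \<le> \<delta> * real (fib (n + 1))"
    using assms \<open>\<delta> > 0\<close> fib_neq_0_nat
    by (intro exp_little_o_eventually_le) auto
  then obtain N where N: "\<And>n. n \<ge> N \<Longrightarrow> ln (real_of_int (b n)) \<le> \<delta> * real (fib (n + 1))"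
    by (auto simp: eventually_sequentially)
  define C where "C = ln (real_of_int (q (Suc N)))"
  have "\<forall>\<^sub>F n in sequentially. C + real n * ln 2 \<le> \<delta> * ((8 / 5) ^ n / 4)"
    using \<open>\<delta> > 0\<close> by real_asymp
  then have "\<forall>\<^sub>F n in sequentially. n > 0 \<and>
      ln (real_of_int (q (Suc n))) \<le> 6 * \<delta> * real_of_int (q n)"
    using eventually_gt_at_top[of "0::nat"] eventually_ge_at_top[of N]
  proof eventually_elim
    case (elim n)
    have "ln (real_of_int (q (Suc n))) \<le> C + real n * ln 2 + \<delta> * real (fib (n + 3))"
      unfolding C_def using N \<open>\<delta> > 0\<close> elim(3) by (intro ln_cf_den_le) auto
    also have "\<delta> * real (fib (n + 3)) \<le> \<delta> * (5 * real (fib n))"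
      using \<open>\<delta> > 0\<close> fib_add_3_le[OF elim(2)] by (intro mult_left_mono) linarith+
    also have "C + real n * ln 2 \<le> \<delta> * real (fib n)"
      using elim(1) mult_left_mono[OF fib_ge_power[OF elim(2)], of \<delta>] \<open>\<delta> > 0\<close> by linarith
    also have "\<delta> * real (fib n) + \<delta> * (5 * real (fib n)) = 6 * \<delta> * real (fib n)" by simp
    also have "\<dots> \<le> 6 * \<delta> * real_of_int (q n)"
      using \<open>\<delta> > 0\<close> cf_den_ge_fib[OF b_pos, of n] by (intro mult_left_mono) linarith+
    finally show ?case using elim by simp
  qed
  then obtain M where M: "\<And>n. n \<ge> M \<Longrightarrow> n > 0 \<and>
      ln (real_of_int (q (Suc n))) \<le> 6 * \<delta> * real_of_int (q n)"
    by (auto simp: eventually_sequentially)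
  have "\<forall>\<^sub>F s in sequentially. ln (2 * real s) < \<delta> * real s"
    using \<open>\<delta> > 0\<close> by real_asymp
  then have "\<forall>\<^sub>F s in sequentially. \<forall>r::int. \<bar>\<alpha> - of_int r / real s\<bar> > 1 / (1 + \<epsilon>) ^ s"
    using approximation_lower_bound[of M] eventually_gt_at_top[of "0::nat"]
  proof eventually_elim
    case (elim s)
    then obtain n where n: "n \<ge> M" "q n \<le> int s"
      "\<And>r::int. 1 / (2 * real s * of_int (q (Suc n))) \<le> \<bar>\<alpha> - of_int r / real s\<bar>" by blast
    have q': "real_of_int (q (Suc n)) > 0" using q_pos[of "Suc n"] by simp
    have "ln (2 * real s * of_int (q (Suc n))) = ln (2 * real s) + ln (of_int (q (Suc n)))"
      using q' elim(3) by (simp add: ln_mult)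
    also have "\<dots> < 8 * \<delta> * real s"
    proof -
      have "6 * \<delta> * real_of_int (q n) \<le> 6 * \<delta> * real s"
        using \<open>\<delta> > 0\<close> n(2) by (intro mult_left_mono) linarith+
      moreover have "\<delta> * real s > 0" using \<open>\<delta> > 0\<close> elim(3) by simp
      ultimately show ?thesis using elim(1) M[OF n(1)] by linarith
    qed
    also have "\<dots> = ln ((1 + \<epsilon>) ^ s)"
      using \<open>\<epsilon> > 0\<close> by (simp add: \<delta>_def ln_realpow)
    finally have "2 * real s * of_int (q (Suc n)) < (1 + \<epsilon>) ^ s"
      using q' elim(3) \<open>\<epsilon> > 0\<close> by (subst (asm) ln_less_cancel_iff) auto
    then have "1 / (1 + \<epsilon>) ^ s < 1 / (2 * real s * of_int (q (Suc n)))"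
      using q' elim(3) \<open>\<epsilon> > 0\<close> by (intro divide_strict_left_mono mult_pos_pos) auto
    then show ?case using n(3) by (metis less_le_trans)
  qed
  then show "\<exists>Q::nat. Q > 0 \<and>
        (\<forall>(r::int) (s::nat). s \<ge> Q \<longrightarrow> \<bar>\<alpha> - of_int r / real s\<bar> > 1 / (1 + \<epsilon>) ^ s)"
    unfolding eventually_sequentially_pos by blast
qed

theorem irrationality_exponent_eq_2:
  assumes "exp_little_o b (\<lambda>n. real n)"
  shows "irrationality_exponent \<alpha> = 2"
proof -
  have "(LEAST \<mu>. \<mu> > 0 \<and> exponent_admissible \<alpha> \<mu>) = 2"
    using exponent_admissible_2[OF assms] exponent_admissible_ge_2
    by (intro Least_equality) auto
  moreover have "\<exists>\<mu>>0. exponent_admissible \<alpha> \<mu>"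
    using exponent_admissible_2[OF assms] by (intro exI[of _ 2]) simp
  ultimately show ?thesis by (simp add: irrationality_exponent_def)
qed

text \<open>Minimality is immediate here, as the constraint \<beta> \<ge> 1 is built into the
  set.\<close>

theorem irrationality_base_eq_1:
  assumes "exp_little_o b (\<lambda>n. real (fib (n + 1)))"
  shows "irrationality_base \<alpha> = 1"
proof -
  have "(LEAST \<beta>. \<beta> \<ge> 1 \<and> base_admissible \<alpha> \<beta>) = 1"
    using base_admissible_1[OF assms] by (intro Least_equality) auto
  moreover have "\<exists>\<beta>\<ge>1. base_admissible \<alpha> \<beta>"
    using base_admissible_1[OF assms] by (intro exI[of _ 1]) simp
  ultimately show ?thesis by (simp add: irrationality_base_def)
qed

end

section \<open>Sufficient growth conditions\<close>

text \<open>Positive integers have nonnegative logarithms, so an upper bound on \<open>b n\<close>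
  suffices for a squeeze.\<close>

lemma exp_little_oI:
  assumes "\<forall>n\<ge>1. b n > 0"
    and "\<forall>\<^sub>F n in sequentially. real_of_int (b n) \<le> exp (h n)"
    and "\<forall>\<^sub>F n in sequentially. g n > 0"
    and "(\<lambda>n. h n / g n) \<longlonglongrightarrow> 0"
  shows "exp_little_o b g"
  unfolding exp_little_o_def
proof (rule tendsto_sandwich[OF _ _ tendsto_const assms(4)])
  show "\<forall>\<^sub>F n in sequentially. 0 \<le> ln (real_of_int (b n)) / g n"
    using assms(3) eventually_ge_at_top[of 1]
  proof eventually_elim
    case (elim n)
    then have "b n \<ge> 1" using assms(1) by (simp add: int_one_le_iff_zero_less)
    with elim show ?case by simp
  qed
  show "\<forall>\<^sub>F n in sequentially. ln (real_of_int (b n)) / g n \<le> h n / g n"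
    using assms(2,3) eventually_ge_at_top[of 1]
  proof eventually_elim
    case (elim n)
    then have "b n > 0" using assms(1) by simp
    then have "ln (real_of_int (b n)) \<le> h n"
      using elim(1) by (metis ln_exp ln_le_cancel_iff exp_gt_zero of_int_0_less_iff)
    with elim show ?case by (intro divide_right_mono) auto
  qed
qed

lemma poly_le_power:
  fixes P :: "real poly"
  obtains C d where "C > 0" "\<And>x. x \<ge> 1 \<Longrightarrow> poly P x \<le> C * x ^ d"
proof -
  have "\<exists>C d. C > 0 \<and> (\<forall>x\<ge>1. poly P x \<le> C * x ^ d)"
  proof (induction P)
    case (pCons a P)
    then obtain C d where C: "C > 0" "\<forall>x\<ge>1. poly P x \<le> C * x ^ d" by blast
    \<comment> \<open>Horner's form a + x P(x): each coefficient raises the degree by one and adds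
      its absolute value to the constant.\<close>
    have "poly (pCons a P) x \<le> (\<bar>a\<bar> + C) * x ^ Suc d" if "x \<ge> 1" for x
    proof -
      have "x * poly P x \<le> x * (C * x ^ d)"
        using C that by (intro mult_left_mono) auto
      moreover have "\<bar>a\<bar> * 1 \<le> \<bar>a\<bar> * x ^ Suc d"
        using that by (intro mult_left_mono one_le_power) auto
      ultimately show ?thesis by (simp add: algebra_simps)
    qed
    then show ?case using C(1) by (intro exI[of _ "\<bar>a\<bar> + C"] exI[of _ "Suc d"]) auto
  qed (auto intro: exI[of _ 1])
  then show ?thesis using that by blast
qed

text \<open>Assuming only an inequality covers bounded partial quotients too, through a constant
  polynomial.\<close>

lemma exp_little_o_poly:
  fixes P :: "real poly"
  assumes "\<forall>n\<ge>1. b n > 0" "\<forall>n\<ge>1. real_of_int (b n) \<le> poly P (real n)"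
  shows "exp_little_o b (\<lambda>n. real n)"
proof -
  obtain C d where C: "C > 0" "\<And>x. x \<ge> 1 \<Longrightarrow> poly P x \<le> C * x ^ d"
    using poly_le_power[of P] by blast
  show ?thesis
  proof (rule exp_little_oI[OF assms(1)])
    show "\<forall>\<^sub>F n in sequentially. real_of_int (b n) \<le> exp (ln C + real d * ln (real n))"
      using eventually_ge_at_top[of 1]
    proof eventually_elim
      case (elim n)
      then have "real_of_int (b n) \<le> C * real n ^ d"
        using assms(2) C(2)[of "real n"] by force
      then show ?case using elim C(1) by (simp add: exp_add exp_of_nat_mult)
    qed
    show "(\<lambda>n. (ln C + real d * ln (real n)) / real n) \<longlonglongrightarrow> 0"
      by real_asymp
  qed (use eventually_gt_at_top[of "0::nat"] in \<open>auto elim: eventually_mono\<close>)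
qed

text \<open>By \<open>fib_ge_power\<close> the quotient is at most a constant times
  (15/16)^n.\<close>

lemma exp_little_o_exp_power:
  assumes "\<forall>n\<ge>1. b n > 0" "\<forall>n\<ge>1. real_of_int (b n) < exp ((3 / 2) ^ n)"
  shows "exp_little_o b (\<lambda>n. real (fib (n + 1)))"
proof (rule exp_little_oI[OF assms(1)])
  show "\<forall>\<^sub>F n in sequentially. real_of_int (b n) \<le> exp ((3 / 2) ^ n)"
    using assms(2) by (intro eventually_sequentiallyI[of 1]) (simp add: less_imp_le)
  show "\<forall>\<^sub>F n in sequentially. 0 < real (fib (n + 1))"
    using fib_neq_0_nat by auto
  show "(\<lambda>n. (3 / 2) ^ n / real (fib (n + 1))) \<longlonglongrightarrow> 0"
  proof (rule tendsto_sandwich[OF _ _ tendsto_const])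
    show "(\<lambda>n. (3 / 2) ^ n / ((8 / 5 :: real) ^ (n + 1) / 4)) \<longlonglongrightarrow> 0"
      by real_asymp
    show "\<forall>\<^sub>F n in sequentially. (3 / 2) ^ n / real (fib (n + 1)) \<le> (3 / 2) ^ n / ((8 / 5) ^ (n + 1) / 4)"
    proof (intro always_eventually allI divide_left_mono mult_pos_pos)
      show "(8 / 5) ^ (n + 1) / 4 \<le> real (fib (n + 1))" for n
        by (rule fib_ge_power) simp
    qed (use fib_neq_0_nat in auto)
  qed auto
qed

text \<open>The bound starts at n = 2: since ln 1 = 0 and division by zero yields 0, at n = 1 it
  would read \<open>b 1 < 1\<close>, contradicting positivity.\<close>

lemma exp_little_o_exp_div_ln:
  assumes "\<forall>n\<ge>1. b n > 0" "\<forall>n\<ge>2. real_of_int (b n) < exp (real n / ln (real n))"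
  shows "exp_little_o b (\<lambda>n. real n)"
proof (rule exp_little_oI[OF assms(1)])
  show "\<forall>\<^sub>F n in sequentially. real_of_int (b n) \<le> exp (real n / ln (real n))"
    using assms(2) by (intro eventually_sequentiallyI[of 2]) (simp add: less_imp_le)
  show "(\<lambda>n. real n / ln (real n) / real n) \<longlonglongrightarrow> 0"
    by real_asymp
qed (use eventually_gt_at_top[of "0::nat"] in \<open>auto elim: eventually_mono\<close>)

theorem corollary3:
  fixes \<alpha> :: real and b :: "nat \<Rightarrow> int"
  assumes "\<alpha> \<notin> \<rat>"
    and "simple_cf_expansion b \<alpha>"
  shows "(exp_little_o b (\<lambda>n. real n) \<longrightarrow> irrationality_exponent \<alpha> = 2)
    \<and> ((\<exists>B. \<forall>n\<ge>1. b n \<le> B) \<longrightarrow> exp_little_o b (\<lambda>n. real n))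
    \<and> ((\<exists>P::real poly. \<forall>n\<ge>1. real_of_int (b n) = poly P (real n)) \<longrightarrow> exp_little_o b (\<lambda>n. real n))
    \<and> ((\<forall>n\<ge>2. real_of_int (b n) < exp (real n / ln (real n))) \<longrightarrow> exp_little_o b (\<lambda>n. real n))
    \<and> (exp_little_o b (\<lambda>n. real (fib (n + 1))) \<longrightarrow> irrationality_base \<alpha> = 1)
    \<and> ((\<forall>n\<ge>1. real_of_int (b n) < exp ((3 / 2) ^ n)) \<longrightarrow> exp_little_o b (\<lambda>n. real (fib (n + 1))))"
proof -
  interpret irrational_cf b \<alpha>
    using assms by unfold_locales
  have "exp_little_o b (\<lambda>n. real n)" if "\<exists>B. \<forall>n\<ge>1. b n \<le> B"
  proof -
    from that obtain B where "\<forall>n\<ge>1. b n \<le> B" by blast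
    then show ?thesis using b_pos by (intro exp_little_o_poly[of b "[:of_int B:]"]) auto
  qed
  moreover have "exp_little_o b (\<lambda>n. real n)"
    if "\<exists>P::real poly. \<forall>n\<ge>1. real_of_int (b n) = poly P (real n)"
    using that exp_little_o_poly[OF b_pos] by (metis order_refl)
  ultimately show ?thesis
    using irrationality_exponent_eq_2 irrationality_base_eq_1
      exp_little_o_exp_div_ln[OF b_pos] exp_little_o_exp_power[OF b_pos] by blast
qed

end
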